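(* Let $V$ be a finite-dimensional Euclidean vector space, $I\subset\mathbb{R}$ an interval, and $R(t)$, $t\in I$, a smooth family of symmetric endomorphisms of $V$; consider the Jacobi equation $Y''(t)+R(t)Y(t)=0$ on $I$. If for some $a<b$ in $I$ the points $a$ and $b$ are conjugate, then for each $\bar a\in I$ with $\bar a\le a$ there is some $\bar b\in[a,b]$ that is conjugate to $\bar a$.
   Context: Points $s<t$ in $I$ are called conjugate if there is a non-zero solution $J:I\to V$ of $Y''+R(t)Y=0$ with $J(s)=J(t)=0$. *)

theory Defs
  imports "HOL-Analysis.Analysis"
begin

text \<open>
  An endomorphism of the Euclidean space is an element of \<open>'a \<Rightarrow>\<^sub>L 'a\<close>: in finite dimension every
  linear map is bounded, and the normed space structure gives meaning to smoothness of
  \<open>R :: real \<Rightarrow> 'a \<Rightarrow>\<^sub>L 'a\<close>. All functions of \<open>t\<close> are total on \<^typ>\<open>real\<close>, but only their values on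
  the interval \<open>I\<close> matter; derivatives are taken within \<open>I\<close>, hence are one-sided at endpoints
  belonging to \<open>I\<close>.
\<close>

definition smooth_on_interval :: "real set \<Rightarrow> (real \<Rightarrow> 'b::real_normed_vector) \<Rightarrow> bool" where
  "smooth_on_interval I f \<longleftrightarrow>
     (\<exists>D :: nat \<Rightarrow> real \<Rightarrow> 'b.
        (\<forall>t\<in>I. D 0 t = f t) \<and>
        (\<forall>n. \<forall>t\<in>I. (D n has_vector_derivative D (Suc n) t) (at t within I)))"

definition symmetric_endomorphism :: "('a::real_inner \<Rightarrow>\<^sub>L 'a) \<Rightarrow> bool" where
  "symmetric_endomorphism A \<longleftrightarrow>
     (\<forall>x y. blinfun_apply A x \<bullet> y = x \<bullet> blinfun_apply A y)"

definition jacobi_solution ::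
    "real set \<Rightarrow> (real \<Rightarrow> 'a::euclidean_space \<Rightarrow>\<^sub>L 'a) \<Rightarrow> (real \<Rightarrow> 'a) \<Rightarrow> bool" where
  "jacobi_solution I R Y \<longleftrightarrow>
     (\<exists>Y' Y'' :: real \<Rightarrow> 'a. \<forall>t\<in>I.
        (Y has_vector_derivative Y' t) (at t within I) \<and>
        (Y' has_vector_derivative Y'' t) (at t within I) \<and>
        Y'' t + blinfun_apply (R t) (Y t) = 0)"

text \<open>The points are ordered, \<open>s < t\<close>; in particular no point is conjugate to itself.\<close>

definition conjugate_points ::
    "real set \<Rightarrow> (real \<Rightarrow> 'a::euclidean_space \<Rightarrow>\<^sub>L 'a) \<Rightarrow> real \<Rightarrow> real \<Rightarrow> bool" where
  "conjugate_points I R s t \<longleftrightarrow>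
     s \<in> I \<and> t \<in> I \<and> s < t \<and>
     (\<exists>J. jacobi_solution I R J \<and> (\<exists>u\<in>I. J u \<noteq> 0) \<and> J s = 0 \<and> J t = 0)"

end

theory Submission
  imports Defs
begin

text \<open>
  Let \<open>A\<close> be the operator-valued solution of the Jacobi equation with \<open>A a' = 0\<close> and
  \<open>A' a' = id\<close>. If no point of \<open>[a, b]\<close> is conjugate to \<open>a'\<close>, then \<open>A t\<close> is invertible for
  \<open>t\<close> in \<open>[a, b]\<close>, so a solution \<open>J\<close> vanishing at \<open>a\<close> and \<open>b\<close> can be written as \<open>J = A c\<close>.
  As in Legendre's treatment of the second variation, with \<open>S = A' A\<^sup>-\<^sup>1\<close> (symmetric, because
  the Wronskian of \<open>A\<close> is constant and vanishes at \<open>a'\<close>) the function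
  \<open>f = (J' - S J) \<bullet> J\<close> has derivative \<open>\<bar>A c'\<bar>\<^sup>2 \<ge> 0\<close>. It vanishes at \<open>a\<close> and \<open>b\<close>, hence
  identically, which gives \<open>J' a = 0\<close> and therefore \<open>J = 0\<close>. It is irrelevant whether \<open>A\<close> is
  singular somewhere between \<open>a'\<close> and \<open>a\<close>.
\<close>

subsection \<open>Linear differential equations on an interval\<close>

text \<open>A derivative at \<open>t\<close> within \<open>I\<close> only sees \<open>I\<close> near
  \<open>t\<close>, so a compact subinterval reaching beyond \<open>t\<close> on every side where
  \<open>I\<close> does gives the same filter. Compactness later bounds the coefficients; the
  initial point \<open>s\<close> is kept inside so that estimates can start there.\<close>

lemma interval_localize:
  fixes I :: "real set"
  assumes I: "is_interval I" and s: "s \<in> I" and t: "t \<in> I"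
  obtains c d where "{c..d} \<subseteq> I" "s \<in> {c..d}" "t \<in> {c..d}" "at t within I = at t within {c..d}"
proof -
  obtain c where c: "c \<in> I" "c \<le> s" "c \<le> t" "(\<exists>x\<in>I. x < t) \<Longrightarrow> c < t"
  proof (cases "\<exists>x\<in>I. x < t")
    case True
    then obtain x where "x \<in> I" "x < t" by blast
    then show ?thesis using that[of "min s x"] s t by (cases "s \<le> x") (auto simp: min_def)
  next
    case False
    then show ?thesis using that[of t] s t by (meson linorder_not_less order_refl)
  qed
  obtain d where d: "d \<in> I" "s \<le> d" "t \<le> d" "(\<exists>x\<in>I. t < x) \<Longrightarrow> t < d"
  proof (cases "\<exists>x\<in>I. t < x")
    case True
    then obtain x where "x \<in> I" "t < x" by blast
    then show ?thesis using that[of "max s x"] s by (auto simp: max_def)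
  next
    case False
    then show ?thesis using that[of t] s t by (meson linorder_not_less order_refl)
  qed
  have sub: "{c..d} \<subseteq> I"
    using mem_is_interval_1_I[OF I c(1) d(1)] by auto
  \<comment> \<open>The window is cut on a side only where \<open>{c..d}\<close> extends strictly
    beyond \<open>t\<close>; on any other side \<open>I\<close> itself ends at
    \<open>t\<close>.\<close>
  define S where "S = (if c < t then {c<..} else UNIV) \<inter> (if t < d then {..<d} else UNIV)"
  have "open S"
    by (simp add: S_def open_Int)
  moreover have "t \<in> S" by (auto simp: S_def)
  moreover have "I \<inter> S - {t} = {c..d} \<inter> S - {t}"
  proof -
    have "x \<in> {c..d}" if "x \<in> I" "x \<in> S" "x \<noteq> t" for x
    proof (cases "x < t")
      case True
      then have "c < t" using c(4) that(1) by blast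
      then have "c < x" using that(2) by (simp add: S_def)
      then show ?thesis using True d(3) by simp
    next
      case False
      then have "t < d" using d(4) that(1,3) by (meson linorder_neqE)
      then have "x < d" using that(2) by (simp add: S_def)
      then show ?thesis using False c(3) by simp
    qed
    then show ?thesis using sub by auto
  qed
  ultimately have "at t within I = at t within {c..d}"
    by (intro at_within_nhd)
  then show thesis using that[of c d] sub c(2,3) d(2,3) by simp
qed

text \<open>This is the mean value inequality with a comparison function, applied below to
  exponential majorants. The one-sided derivatives at the endpoints supply continuity there.\<close>

lemma norm_diff_le_of_derivative_bound:
  fixes f :: "real \<Rightarrow> 'b::real_normed_vector"
  assumes "a \<le> b"
    and f: "\<And>x. x \<in> {a..b} \<Longrightarrow> (f has_vector_derivative f' x) (at x within {a..b})"
    and \<phi>: "\<And>x. x \<in> {a..b} \<Longrightarrow> (\<phi> has_vector_derivative \<phi>' x) (at x within {a..b})"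
    and "\<And>x. x \<in> {a..b} \<Longrightarrow> norm (f' x) \<le> \<phi>' x"
  shows "norm (f b - f a) \<le> \<phi> b - \<phi> a"
proof (cases "a = b")
  case False
  show ?thesis
  proof (rule differentiable_bound_general)
    show "continuous_on {a..b} f"
      using f by (rule continuous_on_vector_derivative)
    show "continuous_on {a..b} \<phi>"
      using \<phi> by (rule continuous_on_vector_derivative)
    show "(f has_vector_derivative f' x) (at x)" "(\<phi> has_vector_derivative \<phi>' x) (at x)"
      if "a < x" "x < b" for x
      using f[of x] \<phi>[of x] that by (simp_all add: at_within_Icc_at)
  qed (use assms False in auto)
qed simp

lemma antiderivative_on_interval:
  fixes g :: "real \<Rightarrow> 'b::banach"
  assumes I: "is_interval I" and s: "s \<in> I" and g: "continuous_on I g"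
  obtains G where "G s = 0" "\<And>t. t \<in> I \<Longrightarrow> (G has_vector_derivative g t) (at t within I)"
proof -
  \<comment> \<open>This is the oriented integral from \<open>s\<close> to \<open>t\<close>; the
    sign is put in by hand because \<open>integral {s..t} g\<close> is 0 for
    \<open>t < s\<close>.\<close>
  define G where "G t = (if s \<le> t then integral {s..t} g else - integral {t..s} g)" for t
  have *: "(G has_vector_derivative g t) (at t within I)" if t: "t \<in> I" for t
  proof -
    obtain c d where cd: "{c..d} \<subseteq> I" "s \<in> {c..d}" "t \<in> {c..d}" "at t within I = at t within {c..d}"
      using interval_localize[OF I s t] by blast
    have gc: "continuous_on {c..d} g" using g cd(1) continuous_on_subset by blast
    \<comment> \<open>On \<open>{c..d}\<close> the function \<open>G\<close> differs from the
      integral with base point \<open>c\<close> by a constant, so both have the same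
      derivative.\<close>
    have *: "integral {c..x} g - integral {c..s} g = G x" if "x \<in> {c..d}" for x
    proof (cases "s \<le> x")
      case True
      have "integral {c..s} g + integral {s..x} g = integral {c..x} g"
        using True that cd(2)
        by (intro Henstock_Kurzweil_Integration.integral_combine integrable_continuous_real
              continuous_on_subset[OF gc]) auto
      then show ?thesis using True by (simp add: G_def algebra_simps)
    next
      case False
      have "integral {c..x} g + integral {x..s} g = integral {c..s} g"
        using False that cd(2)
        by (intro Henstock_Kurzweil_Integration.integral_combine integrable_continuous_real
              continuous_on_subset[OF gc]) auto
      then show ?thesis using False by (simp add: G_def algebra_simps)
    qed
    have "((\<lambda>x. integral {c..x} g - integral {c..s} g) has_vector_derivative g t) (at t within {c..d})"
      using integral_has_vector_derivative[OF gc cd(3)] by (simp add: has_vector_derivative_diff_const)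
    then show ?thesis
      unfolding cd(4) by (rule has_vector_derivative_transform[OF cd(3), rotated]) (rule *[symmetric])
  qed
  have "G s = 0" by (simp add: G_def)
  then show thesis using * by (rule that)
qed

section \<open>Existence by Picard iteration\<close>

text \<open>By linearity the Picard increments satisfy their own recursion: \<open>u (Suc k)\<close>
  is the antiderivative of \<open>B t (u k t)\<close> vanishing at \<open>s\<close>, and the
  solution is the sum of all \<open>u k\<close>. The series is defined at once on all of
  \<open>I\<close>, so no local solutions have to be glued; only its convergence is checked on
  compact subintervals.\<close>

lemma linear_ode_exists:
  fixes B :: "real \<Rightarrow> 'b::banach \<Rightarrow>\<^sub>L 'b"
  assumes I: "is_interval I" and s: "s \<in> I" and B: "continuous_on I B"
  shows "\<exists>z. z s = z\<^sub>0 \<and> (\<forall>t\<in>I. (z has_vector_derivative B t (z t)) (at t within I))"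
proof -
  define P where "P g G \<longleftrightarrow> G s = 0 \<and>
      (\<forall>t\<in>I. (G has_vector_derivative B t (g t)) (at t within I))" for g G :: "real \<Rightarrow> 'b"
  define u where "u = rec_nat (\<lambda>_. z\<^sub>0) (\<lambda>_ g. SOME G. P g G)"
  have u0: "u 0 = (\<lambda>_. z\<^sub>0)" and uSuc: "u (Suc k) = (SOME G. P (u k) G)" for k
    by (simp_all add: u_def)
  have ex: "\<exists>G. P g G" if "continuous_on I g" for g
  proof -
    have "continuous_on I (\<lambda>t. B t (g t))"
      by (rule bounded_bilinear.continuous_on[OF bounded_bilinear_blinfun_apply B that])
    then obtain G where "G s = 0"
      "\<And>t. t \<in> I \<Longrightarrow> (G has_vector_derivative B t (g t)) (at t within I)"
      using antiderivative_on_interval[OF I s] by meson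
    then show ?thesis unfolding P_def by blast
  qed
  have step: "P (u k) (u (Suc k))" if "continuous_on I (u k)" for k
    unfolding uSuc by (rule someI_ex[OF ex[OF that]])
  \<comment> \<open>The choice of \<open>u (Suc k)\<close> is meaningful only once
    \<open>u k\<close> is known to be continuous, hence the induction.\<close>
  have "continuous_on I (u k)" for k
  proof (induction k)
    case (Suc k)
    show ?case
      by (rule continuous_on_vector_derivative[where f' = "\<lambda>t. B t (u k t)"])
        (use step[OF Suc] in \<open>simp add: P_def\<close>)
  qed (simp add: u0)
  then have PS: "P (u k) (u (Suc k))" for k
    by (rule step)
  \<comment> \<open>\<open>v k\<close> is the derivative of \<open>u k\<close>. The constant
    \<open>u 0\<close> contributes 0, and the index shift turns the sum of the \<open>v k\<close>
    into \<open>B t (z t)\<close>.\<close>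
  define v where "v k t = (case k of 0 \<Rightarrow> 0 | Suc j \<Rightarrow> B t (u j t))" for k t
  have v: "(u k has_vector_derivative v k t) (at t within I)" if "t \<in> I" for k t
    using PS that by (cases k) (auto simp: u0 v_def P_def)
  define z where "z t = (\<Sum>k. u k t)" for t
  have us: "u k s = (if k = 0 then z\<^sub>0 else 0)" for k
    using PS by (cases k) (auto simp: u0 P_def)
  have "z s = z\<^sub>0"
    unfolding z_def us using suminf_finite[of "{0}" "\<lambda>k. if k = 0 then z\<^sub>0 else 0"] by simp
  moreover have "(z has_vector_derivative B t (z t)) (at t within I)" if t: "t \<in> I" for t
  proof -
    obtain c d where cd: "{c..d} \<subseteq> I" "s \<in> {c..d}" "t \<in> {c..d}" "at t within I = at t within {c..d}"
      using interval_localize[OF I s t] by blast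
    have "compact (B ` {c..d})"
      using B cd(1) by (intro compact_continuous_image) (auto intro: continuous_on_subset)
    then obtain M where M: "0 < M" "\<And>x. x \<in> {c..d} \<Longrightarrow> norm (B x) \<le> M"
      using compact_imp_bounded bounded_pos by (metis imageI)
    have Bn: "norm (B x y) \<le> M * norm y" if "x \<in> {c..d}" for x y
      using norm_blinfun[of "B x" y] M(2)[OF that] by (meson mult_right_mono norm_ge_zero order_trans)
    define C where "C = norm z\<^sub>0"
    \<comment> \<open>Bielecki's exponential weight makes each Picard step a contraction by \<open>1/2\<close>.\<close>
    have bound: "norm (u k x) \<le> C * (1/2)^k * exp (2 * M * \<bar>x - s\<bar>)" if "x \<in> {c..d}" for k x
      using that
    proof (induction k arbitrary: x)
      case 0
      have "1 \<le> exp (2 * M * \<bar>x - s\<bar>)" using M by simp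
      then have "C * 1 \<le> C * exp (2 * M * \<bar>x - s\<bar>)"
        by (intro mult_left_mono) (auto simp: C_def)
      then show ?case by (simp add: u0 C_def)
    next
      case (Suc k)
      have zero: "u (Suc k) s = 0" using PS by (simp add: P_def)
      have vb: "norm (v (Suc k) y) \<le> M * C * (1/2)^k * exp (2 * M * \<bar>y - s\<bar>)" if "y \<in> {c..d}" for y
      proof -
        have "norm (v (Suc k) y) \<le> M * norm (u k y)" unfolding v_def using Bn that by simp
        also have "\<dots> \<le> M * (C * (1/2)^k * exp (2 * M * \<bar>y - s\<bar>))"
          using M Suc.IH[OF that] by (intro mult_left_mono) auto
        finally show ?thesis by (simp add: mult_ac)
      qed
      have C0: "0 \<le> C * (1/2) ^ Suc k" by (simp add: C_def)
      show ?case
      proof (cases "s \<le> x")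
        case True
        \<comment> \<open>Differentiating the weight yields a factor \<open>2 * M\<close>, which
          turns \<open>(1/2) ^ Suc k\<close> into \<open>M * (1/2)^k\<close>, exactly the bound on
          \<open>v (Suc k)\<close>.\<close>
        define \<phi> where "\<phi> y = C * (1/2) ^ Suc k * exp (2 * M * (y - s))" for y
        have "norm (u (Suc k) x - u (Suc k) s) \<le> \<phi> x - \<phi> s"
        proof (rule norm_diff_le_of_derivative_bound[OF True])
          fix y assume "y \<in> {s..x}"
          then have y: "y \<in> {c..d}" "s \<le> y" using Suc.prems cd(2) by auto
          show "(u (Suc k) has_vector_derivative v (Suc k) y) (at y within {s..x})"
            using v[of y] y cd Suc.prems by (intro has_vector_derivative_within_subset[OF v]) auto
          show "(\<phi> has_vector_derivative M * C * (1/2)^k * exp (2 * M * (y - s))) (at y within {s..x})"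
            unfolding \<phi>_def has_real_derivative_iff_has_vector_derivative[symmetric]
            by (auto intro!: derivative_eq_intros)
          show "norm (v (Suc k) y) \<le> M * C * (1/2)^k * exp (2 * M * (y - s))"
            using vb[OF y(1)] y(2) by simp
        qed
        also have "\<dots> \<le> \<phi> x" using C0 by (simp add: \<phi>_def)
        finally show ?thesis using True by (simp add: \<phi>_def zero)
      next
        case False
        then have le: "x \<le> s" by simp
        \<comment> \<open>To the left of \<open>s\<close> the weight decreases in \<open>y\<close>,
          so the majorant is taken with a minus sign to be increasing.\<close>
        define \<phi> where "\<phi> y = - (C * (1/2) ^ Suc k * exp (2 * M * (s - y)))" for y
        have "norm (u (Suc k) s - u (Suc k) x) \<le> \<phi> s - \<phi> x"
        proof (rule norm_diff_le_of_derivative_bound[OF le])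
          fix y assume "y \<in> {x..s}"
          then have y: "y \<in> {c..d}" "y \<le> s" using Suc.prems cd(2) by auto
          show "(u (Suc k) has_vector_derivative v (Suc k) y) (at y within {x..s})"
            using v[of y] y cd Suc.prems by (intro has_vector_derivative_within_subset[OF v]) auto
          show "(\<phi> has_vector_derivative M * C * (1/2)^k * exp (2 * M * (s - y))) (at y within {x..s})"
            unfolding \<phi>_def has_real_derivative_iff_has_vector_derivative[symmetric]
            by (auto intro!: derivative_eq_intros)
          show "norm (v (Suc k) y) \<le> M * C * (1/2)^k * exp (2 * M * (s - y))"
            using vb[OF y(1)] y(2) by simp
        qed
        also have "\<dots> \<le> - \<phi> x" using C0 by (simp add: \<phi>_def)
        finally show ?thesis using le by (simp add: \<phi>_def zero)
      qed
    qed
    define K where "K = C * exp (2 * M * (d - c))"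
    have K0: "0 \<le> K" by (simp add: K_def C_def)
    have ub: "norm (u k x) \<le> K * (1/2)^k" if "x \<in> {c..d}" for k x
    proof -
      have "exp (2 * M * \<bar>x - s\<bar>) \<le> exp (2 * M * (d - c))"
        using M that cd(2) by auto
      then have "C * (1/2)^k * exp (2 * M * \<bar>x - s\<bar>) \<le> C * (1/2)^k * exp (2 * M * (d - c))"
        by (intro mult_left_mono) (auto simp: C_def)
      with bound[OF that, of k] show ?thesis by (simp add: K_def mult_ac)
    qed
    \<comment> \<open>The factor 2 pays for the index shift between \<open>v (Suc j)\<close> and
      \<open>u j\<close>.\<close>
    have vb: "norm (v k x) \<le> 2 * M * K * (1/2)^k" if "x \<in> {c..d}" for k x
    proof (cases k)
      case (Suc j)
      have "norm (B x (u j x)) \<le> M * (K * (1/2)^j)"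
        using Bn[OF that, of "u j x"] ub[OF that, of j] M by (smt (verit) mult_left_mono)
      then show ?thesis by (simp add: Suc v_def mult_ac)
    qed (use K0 M in \<open>simp add: v_def\<close>)
    have geo: "summable (\<lambda>k. r * (1/2)^k)" for r :: real
      by (intro summable_mult summable_geometric) simp
    have summ: "summable (\<lambda>k. u k x)" if "x \<in> {c..d}" for x
      by (rule summable_comparison_test'[OF geo[of K]]) (rule ub[OF that])
    have sumv: "(\<Sum>k. v k x) = B x (z x)" if "x \<in> {c..d}" for x
    proof -
      have "(\<lambda>k. v (Suc k) x) sums B x (z x)"
        unfolding v_def z_def old.nat.case
        by (intro bounded_linear.sums[OF blinfun.bounded_linear_right] summable_sums summ that)
      then have "(\<lambda>k. v k x) sums B x (z x)"
        by (rule sums_Suc_imp[rotated]) (simp add: v_def)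
      then show ?thesis
        by (rule sums_unique[symmetric])
    qed
    have unif: "uniform_limit {c..d} (\<lambda>n x. \<Sum>i<n. v i x) (\<lambda>x. B x (z x)) sequentially"
    proof (rule uniform_limit_cong'[THEN iffD1, OF _ _ Weierstrass_m_test[OF vb geo]])
      show "(\<Sum>i. v i x) = B x (z x)" if "x \<in> {c..d}" for x
        by (rule sumv[OF that])
    qed simp_all
    \<comment> \<open>Termwise differentiation: the derivatives converge uniformly, and convergence
      of the series at the single point \<open>t\<close> suffices. The resulting \<open>g\<close> is
      then identified with \<open>z\<close>.\<close>
    have "\<exists>g. \<forall>x\<in>{c..d}. (\<lambda>n. u n x) sums g x \<and>
        (g has_derivative (\<lambda>h. h *\<^sub>R B x (z x))) (at x within {c..d})"
    proof (rule has_derivative_series[where f' = "\<lambda>n x h. h *\<^sub>R v n x"])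
      show "(u n has_derivative (\<lambda>h. h *\<^sub>R v n x)) (at x within {c..d})" if "x \<in> {c..d}" for n x
        using v[of x n, unfolded has_vector_derivative_def] cd(1) that
        by (meson has_derivative_subset subsetD)
      show "\<forall>\<^sub>F n in sequentially. \<forall>x\<in>{c..d}. \<forall>h.
          norm ((\<Sum>i<n. h *\<^sub>R v i x) - h *\<^sub>R B x (z x)) \<le> e * norm h" if "e > 0" for e
        using uniform_limitD[OF unif that]
      proof eventually_elim
        case (elim n)
        show ?case
        proof safe
          fix x h assume "x \<in> {c..d}"
          then have "norm ((\<Sum>i<n. v i x) - B x (z x)) \<le> e"
            using elim by (metis dist_norm less_imp_le)
          then have "\<bar>h\<bar> * norm ((\<Sum>i<n. v i x) - B x (z x)) \<le> \<bar>h\<bar> * e"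
            by (intro mult_left_mono) auto
          moreover have "(\<Sum>i<n. h *\<^sub>R v i x) - h *\<^sub>R B x (z x)
              = h *\<^sub>R ((\<Sum>i<n. v i x) - B x (z x))"
            by (simp only: scaleR_sum_right scaleR_diff_right)
          ultimately show "norm ((\<Sum>i<n. h *\<^sub>R v i x) - h *\<^sub>R B x (z x)) \<le> e * norm h"
            by (simp only: norm_scaleR real_norm_def mult.commute)
        qed
      qed
      show "(\<lambda>n. u n t) sums z t" unfolding z_def using summ[OF cd(3)] by (rule summable_sums)
    qed (use cd(3) in auto)
    then obtain g where g: "\<And>x. x \<in> {c..d} \<Longrightarrow> (\<lambda>n. u n x) sums g x"
      "\<And>x. x \<in> {c..d} \<Longrightarrow> (g has_vector_derivative B x (z x)) (at x within {c..d})"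
      unfolding has_vector_derivative_def by blast
    have "z x = g x" if "x \<in> {c..d}" for x
      using g(1)[OF that] by (simp add: z_def sums_iff)
    then show ?thesis
      unfolding cd(4) by (rule has_vector_derivative_transform[OF cd(3) _ g(2)[OF cd(3)]])
  qed
  ultimately show ?thesis by blast
qed

section \<open>Monotonicity, Gronwall's argument and uniqueness\<close>

lemma nondecreasing_of_derivative_nonneg:
  fixes f :: "real \<Rightarrow> real"
  assumes "a \<le> b"
    and "\<And>x. x \<in> {a..b} \<Longrightarrow> (f has_vector_derivative f' x) (at x within {a..b})"
    and "\<And>x. x \<in> {a..b} \<Longrightarrow> 0 \<le> f' x"
  shows "f a \<le> f b"
  using norm_diff_le_of_derivative_bound[where f = "\<lambda>_. 0 :: real" and f' = "\<lambda>_. 0"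
      and \<phi> = f and \<phi>' = f', OF assms(1)] assms by simp

text \<open>The two-sided bound on \<open>E'\<close> makes \<open>E x * exp (- L * x)\<close>
  nonincreasing and \<open>E x * exp (L * x)\<close> nondecreasing. Starting from the zero at
  \<open>s\<close>, the first gives \<open>E x \<le> 0\<close> to the right and the second to the
  left.\<close>

lemma gronwall_zero:
  fixes E :: "real \<Rightarrow> real"
  assumes E: "\<And>x. x \<in> {c..d} \<Longrightarrow> (E has_vector_derivative E' x) (at x within {c..d})"
    and bound: "\<And>x. x \<in> {c..d} \<Longrightarrow> \<bar>E' x\<bar> \<le> L * E x"
    and nonneg: "\<And>x. x \<in> {c..d} \<Longrightarrow> 0 \<le> E x"
    and s: "s \<in> {c..d}" "E s = 0" and x: "x \<in> {c..d}"
  shows "E x = 0"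
proof -
  have "E x \<le> 0"
  proof (cases "s \<le> x")
    case True
    have "- (E s * exp (- L * s)) \<le> - (E x * exp (- L * x))"
    proof (rule nondecreasing_of_derivative_nonneg[OF True,
          where f' = "\<lambda>y. (L * E y - E' y) * exp (- L * y)"])
      fix y assume "y \<in> {s..x}"
      then have y: "y \<in> {c..d}" using s x by auto
      have "(E has_vector_derivative E' y) (at y within {s..x})"
        using s x by (intro has_vector_derivative_within_subset[OF E[OF y]]) auto
      then show "((\<lambda>y. - (E y * exp (- L * y))) has_vector_derivative
          (L * E y - E' y) * exp (- L * y)) (at y within {s..x})"
        unfolding has_real_derivative_iff_has_vector_derivative[symmetric]
        by (auto intro!: derivative_eq_intros simp: algebra_simps)
      show "0 \<le> (L * E y - E' y) * exp (- L * y)"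
        using bound[OF y] by simp
    qed
    then show ?thesis using s by (simp add: mult_le_0_iff)
  next
    case False
    then have le: "x \<le> s" by simp
    have "E x * exp (L * x) \<le> E s * exp (L * s)"
    proof (rule nondecreasing_of_derivative_nonneg[OF le,
          where f' = "\<lambda>y. (L * E y + E' y) * exp (L * y)"])
      fix y assume "y \<in> {x..s}"
      then have y: "y \<in> {c..d}" using s x by auto
      have "(E has_vector_derivative E' y) (at y within {x..s})"
        using s x by (intro has_vector_derivative_within_subset[OF E[OF y]]) auto
      then show "((\<lambda>y. E y * exp (L * y)) has_vector_derivative
          (L * E y + E' y) * exp (L * y)) (at y within {x..s})"
        unfolding has_real_derivative_iff_has_vector_derivative[symmetric]
        by (auto intro!: derivative_eq_intros simp: algebra_simps)
      show "0 \<le> (L * E y + E' y) * exp (L * y)"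
        using bound[OF y] by simp
    qed
    then show ?thesis using s by (simp add: mult_le_0_iff)
  qed
  then show ?thesis using nonneg[OF x] by simp
qed

text \<open>The energy \<open>z x \<bullet> z x\<close> has derivative at most \<open>2 * M\<close>
  times itself in absolute value, by Cauchy-Schwarz and a bound \<open>M\<close> for
  \<open>B\<close> on the compact interval between \<open>s\<close> and \<open>t\<close>; Gronwall's
  argument applies.\<close>

lemma linear_ode_zero_unique:
  fixes B :: "real \<Rightarrow> 'b::real_inner \<Rightarrow>\<^sub>L 'b"
  assumes I: "is_interval I" and B: "continuous_on I B"
    and z: "\<And>t. t \<in> I \<Longrightarrow> (z has_vector_derivative B t (z t)) (at t within I)"
    and s: "s \<in> I" "z s = 0" and t: "t \<in> I"
  shows "z t = 0"
proof -
  define c d where "c = min s t" and "d = max s t"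
  have cd: "s \<in> {c..d}" "t \<in> {c..d}" "c \<in> I" "d \<in> I"
    using s t by (auto simp: c_def d_def min_def max_def)
  have sub: "{c..d} \<subseteq> I"
    using mem_is_interval_1_I[OF I cd(3,4)] by auto
  have "compact (B ` {c..d})"
    using B sub by (intro compact_continuous_image) (auto intro: continuous_on_subset)
  then obtain M where M: "0 < M" "\<And>x. x \<in> {c..d} \<Longrightarrow> norm (B x) \<le> M"
    using compact_imp_bounded bounded_pos by (metis imageI)
  have "z t \<bullet> z t = 0"
  proof (rule gronwall_zero[where E = "\<lambda>x. z x \<bullet> z x" and s = s and L = "2 * M"
        and E' = "\<lambda>x. z x \<bullet> B x (z x) + B x (z x) \<bullet> z x"])
    fix x assume x: "x \<in> {c..d}"
    have "(z has_vector_derivative B x (z x)) (at x within {c..d})"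
      using x sub by (intro has_vector_derivative_within_subset[OF z]) auto
    then show "((\<lambda>x. z x \<bullet> z x) has_vector_derivative
        z x \<bullet> B x (z x) + B x (z x) \<bullet> z x) (at x within {c..d})"
      using bounded_bilinear.has_vector_derivative[OF bounded_bilinear_inner] by blast
    have "\<bar>z x \<bullet> B x (z x)\<bar> \<le> norm (z x) * norm (B x (z x))"
      by (rule Cauchy_Schwarz_ineq2)
    also have "norm (B x (z x)) \<le> M * norm (z x)"
      using norm_blinfun[of "B x" "z x"] M(2)[OF x] by (meson mult_right_mono norm_ge_zero order_trans)
    then have "norm (z x) * norm (B x (z x)) \<le> norm (z x) * (M * norm (z x))"
      by (intro mult_left_mono) auto
    also have "\<dots> = M * (z x \<bullet> z x)"
      by (simp add: dot_square_norm power2_eq_square)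
    finally show "\<bar>z x \<bullet> B x (z x) + B x (z x) \<bullet> z x\<bar> \<le> 2 * M * (z x \<bullet> z x)"
      by (simp add: inner_commute)
  qed (use cd s in auto)
  then show ?thesis by simp
qed

section \<open>Reduction from second to first order\<close>

text \<open>The pair of a solution and its derivative satisfies a first-order system. The product
  \<open>p\<close> is left abstract because the reduction is used twice: with operators applied to
  vectors, and with operators composed with operators.\<close>

lemma second_order_as_first_order:
  fixes p :: "'c::real_normed_vector \<Rightarrow> 'b::real_normed_vector \<Rightarrow> 'b"
  assumes p: "bounded_bilinear p" and R: "continuous_on I R"
  shows "\<exists>B. continuous_on I (B :: real \<Rightarrow> ('b \<times> 'b) \<Rightarrow>\<^sub>L ('b \<times> 'b)) \<and>
    (\<forall>t x y. B t (x, y) = (y, - p (R t) x))"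
proof -
  \<comment> \<open>Bilinearity makes the lower block a bounded linear function of
    \<open>R t\<close>, so continuity of \<open>R\<close> passes to the system operator.\<close>
  have q: "bounded_bilinear (\<lambda>C (z :: 'b \<times> 'b). (0, - p C (fst z)) :: 'b \<times> 'b)"
  proof -
    obtain K where K: "\<And>C x. norm (p C x) \<le> norm C * norm x * K" "0 < K"
      using bounded_bilinear.pos_bounded[OF p] by blast
    have "norm ((0, - p C (fst z)) :: 'b \<times> 'b) \<le> norm C * norm z * K" for C and z :: "'b \<times> 'b"
    proof -
      have "norm ((0, - p C (fst z)) :: 'b \<times> 'b) = norm (p C (fst z))"
        by (simp add: norm_Pair)
      also have "\<dots> \<le> norm C * norm (fst z) * K" by (rule K(1))
      also have "\<dots> \<le> norm C * norm z * K"
        using norm_fst_le[of "fst z" "snd z"] K(2) by (intro mult_right_mono mult_left_mono) auto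
      finally show ?thesis .
    qed
    then have "\<exists>K. \<forall>C (z :: 'b \<times> 'b). norm ((0, - p C (fst z)) :: 'b \<times> 'b) \<le> norm C * norm z * K"
      by blast
    then show ?thesis
      by (intro bounded_bilinear.intro)
        (simp_all add: bounded_bilinear.add_left[OF p] bounded_bilinear.add_right[OF p]
          bounded_bilinear.scaleR_left[OF p] bounded_bilinear.scaleR_right[OF p])
  qed
  interpret q: bounded_bilinear "\<lambda>C (z :: 'b \<times> 'b). (0, - p C (fst z)) :: 'b \<times> 'b"
    by (rule q)
  have P: "bounded_linear (\<lambda>z :: 'b \<times> 'b. (snd z, 0 :: 'b))"
    by (intro bounded_linear_Pair bounded_linear_snd bounded_linear_zero)
  define B where "B t = Blinfun (\<lambda>z :: 'b \<times> 'b. (snd z, 0 :: 'b)) + q.prod_right (R t)" for t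
  have "continuous_on I B"
    unfolding B_def
    by (intro continuous_intros bounded_linear.continuous_on[OF q.bounded_linear_prod_right R])
  moreover have "B t (x, y) = (y, - p (R t) x)" for t x y
    by (simp add: B_def blinfun.add_left bounded_linear_Blinfun_apply[OF P])
  ultimately show ?thesis by blast
qed

subsection \<open>The Jacobi equation\<close>

text \<open>This serves to show that a non-zero Jacobi field has non-zero derivative wherever it
  vanishes.\<close>

lemma jacobi_zero_unique:
  fixes R :: "real \<Rightarrow> 'a::euclidean_space \<Rightarrow>\<^sub>L 'a"
  assumes I: "is_interval I" and R: "continuous_on I R"
    and Y: "\<And>t. t \<in> I \<Longrightarrow> (Y has_vector_derivative Y' t) (at t within I)"
    and Y': "\<And>t. t \<in> I \<Longrightarrow> (Y' has_vector_derivative - R t (Y t)) (at t within I)"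
    and s: "s \<in> I" "Y s = 0" "Y' s = 0" and t: "t \<in> I"
  shows "Y t = 0"
proof -
  obtain B :: "real \<Rightarrow> ('a \<times> 'a) \<Rightarrow>\<^sub>L ('a \<times> 'a)"
    where B: "continuous_on I B" "\<And>t x y. B t (x, y) = (y, - R t x)"
    using second_order_as_first_order[OF bounded_bilinear_blinfun_apply R] by blast
  have "(Y t, Y' t) = 0"
  proof (rule linear_ode_zero_unique[OF I B(1) _ s(1) _ t, where z = "\<lambda>t. (Y t, Y' t)"])
    show "((\<lambda>t. (Y t, Y' t)) has_vector_derivative B t (Y t, Y' t)) (at t within I)" if "t \<in> I" for t
      using has_derivative_Pair[OF Y[OF that, unfolded has_vector_derivative_def]
          Y'[OF that, unfolded has_vector_derivative_def]]
      by (simp add: has_vector_derivative_def B(2))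
  qed (simp add: s zero_prod_def)
  then show ?thesis by (simp add: zero_prod_def)
qed

text \<open>For each \<open>v\<close>, the curve \<open>A t v\<close> is the Jacobi field with value
  0 and derivative \<open>v\<close> at \<open>s\<close>. Thus kernel vectors of \<open>A t\<close>
  yield Jacobi fields vanishing at both \<open>s\<close> and \<open>t\<close>.\<close>

lemma jacobi_operator_solution:
  fixes R :: "real \<Rightarrow> 'a::banach \<Rightarrow>\<^sub>L 'a"
  assumes I: "is_interval I" and R: "continuous_on I R" and s: "s \<in> I"
  obtains A A' :: "real \<Rightarrow> 'a \<Rightarrow>\<^sub>L 'a"
  where "A s = 0" "A' s = id_blinfun"
    "\<And>t. t \<in> I \<Longrightarrow> (A has_vector_derivative A' t) (at t within I)"
    "\<And>t. t \<in> I \<Longrightarrow> (A' has_vector_derivative - (R t o\<^sub>L A t)) (at t within I)"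
proof -
  obtain B :: "real \<Rightarrow> (('a \<Rightarrow>\<^sub>L 'a) \<times> ('a \<Rightarrow>\<^sub>L 'a)) \<Rightarrow>\<^sub>L (('a \<Rightarrow>\<^sub>L 'a) \<times> ('a \<Rightarrow>\<^sub>L 'a))"
    where B: "continuous_on I B" "\<And>t X Y. B t (X, Y) = (Y, - (R t o\<^sub>L X))"
    using second_order_as_first_order[OF bounded_bilinear_blinfun_compose R] by blast
  obtain z where z: "z s = (0, id_blinfun)"
    "\<And>t. t \<in> I \<Longrightarrow> (z has_vector_derivative B t (z t)) (at t within I)"
    using linear_ode_exists[OF I s B(1)] by blast
  have Bz: "B t (z t) = (snd (z t), - (R t o\<^sub>L fst (z t)))" for t
    using B(2)[of t "fst (z t)" "snd (z t)"] by simp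
  show thesis
  proof (rule that[of "\<lambda>t. fst (z t)" "\<lambda>t. snd (z t)"])
    fix t assume t: "t \<in> I"
    show "((\<lambda>t. fst (z t)) has_vector_derivative snd (z t)) (at t within I)"
      using bounded_linear.has_vector_derivative[OF bounded_linear_fst z(2)[OF t]] by (simp add: Bz)
    show "((\<lambda>t. snd (z t)) has_vector_derivative - (R t o\<^sub>L fst (z t))) (at t within I)"
      using bounded_linear.has_vector_derivative[OF bounded_linear_snd z(2)[OF t]] by (simp add: Bz)
  qed (simp_all add: z(1))
qed

text \<open>The difference \<open>W\<close> of the two sides is the Wronskian of the fields
  \<open>A t x\<close> and \<open>A t y\<close>. In its derivative the terms with \<open>A'\<close>
  cancel, and those with \<open>R\<close> cancel by symmetry; so it keeps its value 0 from
  \<open>s\<close>.\<close>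

lemma jacobi_operator_lagrange:
  fixes R A A' :: "real \<Rightarrow> 'a::euclidean_space \<Rightarrow>\<^sub>L 'a"
  assumes I: "is_interval I"
    and sym: "\<And>t. t \<in> I \<Longrightarrow> symmetric_endomorphism (R t)"
    and A: "\<And>t. t \<in> I \<Longrightarrow> (A has_vector_derivative A' t) (at t within I)"
    and A': "\<And>t. t \<in> I \<Longrightarrow> (A' has_vector_derivative - (R t o\<^sub>L A t)) (at t within I)"
    and s: "s \<in> I" "A s = 0" and t: "t \<in> I"
  shows "A' t x \<bullet> A t y = A t x \<bullet> A' t y"
proof -
  define W where "W t = A' t x \<bullet> A t y - A t x \<bullet> A' t y" for t
  have "(W has_vector_derivative 0) (at t within I)" if t: "t \<in> I" for t
  proof -
    have a: "((\<lambda>t. A t v) has_vector_derivative A' t v) (at t within I)"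
      and a': "((\<lambda>t. A' t v) has_vector_derivative - R t (A t v)) (at t within I)" for v
      using bounded_linear.has_vector_derivative[OF blinfun.bounded_linear_left A[OF t]]
        bounded_linear.has_vector_derivative[OF blinfun.bounded_linear_left A'[OF t]]
      by (simp_all add: blinfun.minus_left)
    have "(W has_vector_derivative (A' t x \<bullet> A' t y + (- R t (A t x)) \<bullet> A t y)
        - (A t x \<bullet> (- R t (A t y)) + A' t x \<bullet> A' t y)) (at t within I)"
      unfolding W_def
      by (intro has_vector_derivative_diff
          bounded_bilinear.has_vector_derivative[OF bounded_bilinear_inner] a a')
    moreover have "R t (A t x) \<bullet> A t y = A t x \<bullet> R t (A t y)"
      using sym[OF t] by (simp add: symmetric_endomorphism_def)
    ultimately show ?thesis by simp
  qed
  then obtain k where "\<And>t. t \<in> I \<Longrightarrow> W t = k"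
    using has_vector_derivative_zero_constant[of I W] I is_interval_convex by blast
  then have "W t = W s" using s t by simp
  then show ?thesis by (simp add: W_def s)
qed

section \<open>Legendre's argument where \<open>A\<close> is nonsingular\<close>

text \<open>The solution \<open>c\<close> of \<open>A s (c s) = J s\<close> is differentiated
  without forming an inverse: near \<open>t\<close> the operators \<open>A s\<close> are uniformly
  bounded below, so a remainder of \<open>c\<close> is small as soon as its image under
  \<open>A s\<close> is.\<close>

lemma has_vector_derivative_solve:
  fixes A :: "real \<Rightarrow> 'a::real_normed_vector \<Rightarrow>\<^sub>L 'b::euclidean_space"
  assumes A: "(A has_vector_derivative A') (at t within S)"
    and J: "(J has_vector_derivative J') (at t within S)"
    and c: "\<And>s. s \<in> S \<Longrightarrow> A s (c s) = J s"
    and inj: "inj (A t)" and t: "t \<in> S" and c': "A t c' = J' - A' (c t)"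
  shows "(c has_vector_derivative c') (at t within S)"
proof -
  obtain m where m: "0 < m" "\<And>x. m * norm x \<le> norm (A t x)"
    using linear_inj_bounded_below_pos[of "A t"] inj blinfun.bounded_linear_right
      bounded_linear.linear by metis
  have "(A \<longlongrightarrow> A t) (at t within S)"
    using has_vector_derivative_continuous[OF A] by (simp add: continuous_within)
  \<comment> \<open>A perturbation smaller than \<open>m / 2\<close> leaves at least half of the
    lower bound \<open>m\<close>.\<close>
  then have "\<forall>\<^sub>F s in at t within S. dist (A s) (A t) < m / 2"
    using m(1) by (intro tendstoD) auto
  then obtain e where e: "0 < e"
    "\<And>s. s \<in> S \<Longrightarrow> s \<noteq> t \<Longrightarrow> dist s t < e \<Longrightarrow> norm (A s - A t) < m / 2"
    unfolding eventually_at dist_norm[of "A _"] by blast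
  have below: "norm x \<le> 2 / m * norm (A s x)" if "s \<in> S" "s \<noteq> t" "dist s t < e" for s x
  proof -
    have "norm ((A s - A t) x) \<le> m / 2 * norm x"
      using norm_blinfun[of "A s - A t" x] e(2)[OF that]
      by (meson less_imp_le mult_right_mono norm_ge_zero order_trans)
    moreover have "norm (A t x) \<le> norm (A s x) + norm ((A s - A t) x)"
      using norm_triangle_ineq4[of "A s x" "(A s - A t) x"] by (simp add: blinfun.diff_left)
    ultimately have "m / 2 * norm x \<le> norm (A s x)"
      using m(2)[of x] by simp
    then show ?thesis using m(1) by (simp add: field_simps)
  qed
  \<comment> \<open>Applying \<open>A s\<close> to the remainder of \<open>c\<close> gives \<open>g s\<close>, which is differentiable by hypothesis.\<close>
  define g where "g s = J s - A s (c t) - (s - t) *\<^sub>R A s c'" for s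
  \<comment> \<open>At \<open>t\<close> this derivative is \<open>J' - A' (c t) - A t c'\<close>,
    which is 0 by the choice of \<open>c'\<close>; so \<open>g s\<close> is of smaller order than
    \<open>s - t\<close>.\<close>
  have "(g has_vector_derivative J' - A' (c t) - ((t - t) *\<^sub>R A' c' + (1 - 0) *\<^sub>R A t c')) (at t within S)"
    unfolding g_def
    by (intro has_vector_derivative_diff J has_vector_derivative_id has_vector_derivative_const
        bounded_bilinear.has_vector_derivative[OF bounded_bilinear_scaleR]
        bounded_linear.has_vector_derivative[OF blinfun.bounded_linear_left A])
  moreover have "g t = 0" using c[OF t] by (simp add: g_def)
  ultimately have lim: "((\<lambda>s. norm (g s) / norm (s - t)) \<longlongrightarrow> 0) (at t within S)"
    by (simp add: c' has_vector_derivative_def has_derivative_iff_norm)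
  show ?thesis
    unfolding has_vector_derivative_def
  proof (rule has_derivativeI_sandwich[OF e(1)])
    show "((\<lambda>s. 2 / m * (norm (g s) / norm (s - t))) \<longlongrightarrow> 0) (at t within S)"
      using tendsto_mult_right_zero[OF lim] .
    fix s assume s: "s \<in> S" "s \<noteq> t" "dist s t < e"
    have "g s = A s (c s - c t - (s - t) *\<^sub>R c')"
      by (simp add: g_def c[OF s(1), symmetric] blinfun.diff_right blinfun.scaleR_right)
    then have "norm (c s - c t - (s - t) *\<^sub>R c') \<le> 2 / m * norm (g s)"
      using below[OF s] by simp
    then show "norm (c s - c t - (s - t) *\<^sub>R c') / norm (s - t) \<le> 2 / m * (norm (g s) / norm (s - t))"
      unfolding times_divide_eq_right by (rule divide_right_mono) simp
  qed (rule bounded_linear_scaleR_left)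
qed

text \<open>Write \<open>J = A c\<close>. The function \<open>f\<close> is nondecreasing and
  vanishes at both ends, hence is constant; its derivative at \<open>a\<close> then gives
  \<open>A a (c' a) = 0\<close>. Injectivity and \<open>J a = 0\<close> give \<open>c a = 0\<close>,
  so \<open>J' a = A' a (c a) + A a (c' a) = 0\<close>.\<close>

lemma no_conjugate_of_nonsingular:
  fixes R A A' :: "real \<Rightarrow> 'a::euclidean_space \<Rightarrow>\<^sub>L 'a"
  assumes ab: "a < b"
    and A: "\<And>t. t \<in> {a..b} \<Longrightarrow> (A has_vector_derivative A' t) (at t within {a..b})"
    and A': "\<And>t. t \<in> {a..b} \<Longrightarrow> (A' has_vector_derivative - (R t o\<^sub>L A t)) (at t within {a..b})"
    and lagrange: "\<And>t x y. t \<in> {a..b} \<Longrightarrow> A' t x \<bullet> A t y = A t x \<bullet> A' t y"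
    and inj: "\<And>t. t \<in> {a..b} \<Longrightarrow> inj (A t)"
    and J: "\<And>t. t \<in> {a..b} \<Longrightarrow> (J has_vector_derivative J' t) (at t within {a..b})"
    and J': "\<And>t. t \<in> {a..b} \<Longrightarrow> (J' has_vector_derivative - R t (J t)) (at t within {a..b})"
    and "J a = 0" "J b = 0"
  shows "J' a = 0"
proof -
  have surj: "\<exists>x. A t x = y" if "t \<in> {a..b}" for t y
    using linear_injective_imp_surjective[of "A t"] inj[OF that] blinfun.bounded_linear_right
      bounded_linear.linear by (metis surjD)
  define c where "c t = (SOME x. A t x = J t)" for t
  \<comment> \<open>The product rule for \<open>J = A c\<close> forces this value of the derivative
    of \<open>c\<close>.\<close>
  define c' where "c' t = (SOME x. A t x = J' t - A' t (c t))" for t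
  have c: "A t (c t) = J t" if "t \<in> {a..b}" for t
    unfolding c_def using surj[OF that] by (rule someI_ex)
  have c': "A t (c' t) = J' t - A' t (c t)" if "t \<in> {a..b}" for t
    unfolding c'_def using surj[OF that] by (rule someI_ex)
  define f where "f t = (J' t - A' t (c t)) \<bullet> J t" for t
  have f: "(f has_vector_derivative A t (c' t) \<bullet> A t (c' t)) (at t within {a..b})"
    if t: "t \<in> {a..b}" for t
  proof -
    have dc: "(c has_vector_derivative c' t) (at t within {a..b})"
      by (rule has_vector_derivative_solve[OF A[OF t] J[OF t] c inj[OF t] t c'[OF t]])
    have "(f has_vector_derivative (J' t - A' t (c t)) \<bullet> J' t
        + (- R t (J t) - (A' t (c' t) + (- (R t o\<^sub>L A t)) (c t))) \<bullet> J t) (at t within {a..b})"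
      unfolding f_def
      by (intro bounded_bilinear.has_vector_derivative[OF bounded_bilinear_inner]
          bounded_bilinear.has_vector_derivative[OF bounded_bilinear_blinfun_apply]
          has_vector_derivative_diff J[OF t] J'[OF t] A'[OF t] dc)
    \<comment> \<open>The two terms with \<open>R t\<close> cancel since
      \<open>A t (c t) = J t\<close>. The Lagrange identity then moves the prime in the last term,
      leaving the square of \<open>A t (c' t)\<close>.\<close>
    moreover have "(J' t - A' t (c t)) \<bullet> J' t
        + (- R t (J t) - (A' t (c' t) + (- (R t o\<^sub>L A t)) (c t))) \<bullet> J t
        = A t (c' t) \<bullet> J' t - A' t (c' t) \<bullet> A t (c t)"
      by (simp add: c'[OF t] c[OF t] blinfun.minus_left inner_diff_left)
    moreover have "A' t (c' t) \<bullet> A t (c t) = A t (c' t) \<bullet> A' t (c t)"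
      by (rule lagrange[OF t])
    ultimately show ?thesis
      by (simp add: c'[OF t] inner_diff_right)
  qed
  have mono: "f x \<le> f y" if "a \<le> x" "x \<le> y" "y \<le> b" for x y
    by (rule nondecreasing_of_derivative_nonneg[OF that(2)])
      (use that in \<open>auto intro!: has_vector_derivative_within_subset[OF f]\<close>)
  have "f a = 0" "f b = 0" using assms(8,9) by (simp_all add: f_def)
  then have "f t = 0" if "t \<in> {a..b}" for t
    using mono[of a t] mono[of t b] that by auto
  then have "(f has_vector_derivative 0) (at a within {a..b})"
    using ab by (intro has_vector_derivative_transform[OF _ _ has_vector_derivative_const]) auto
  then have "A a (c' a) \<bullet> A a (c' a) = 0"
    using f[of a] ab
    by (intro vector_derivative_unique_within_closed_interval[of a b a f]) (auto simp: cbox_interval)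
  moreover have "c a = 0"
  proof -
    have "A a (c a) = A a 0" using c[of a] ab assms(8) by simp
    then show ?thesis using injD[OF inj[of a]] ab by (metis atLeastAtMost_iff less_imp_le order_refl)
  qed
  ultimately show ?thesis using c'[of a] ab by simp
qed

section \<open>Finding the conjugate point in \<open>[a, b]\<close>\<close>

theorem corollary1p3:
  fixes I :: "real set"
    and R :: "real \<Rightarrow> 'a::euclidean_space \<Rightarrow>\<^sub>L 'a"
    and a b :: real
  assumes "is_interval I"
    and "smooth_on_interval I R"
    and "\<And>t. t \<in> I \<Longrightarrow> symmetric_endomorphism (R t)"
    and "a \<in> I" and "b \<in> I" and "a < b"
    and "conjugate_points I R a b"
  shows "\<forall>a'\<in>I. a' \<le> a \<longrightarrow> (\<exists>b'\<in>{a..b}. conjugate_points I R a' b')"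
proof (intro ballI impI)
  fix a' assume a': "a' \<in> I" "a' \<le> a"
  show "\<exists>b'\<in>{a..b}. conjugate_points I R a' b'"
  \<comment> \<open>For \<open>a' = a\<close> the operator \<open>A a\<close> is zero, so the
    singular point found below might be \<open>a\<close> itself, which is not conjugate to itself;
    here \<open>b\<close> serves directly.\<close>
  proof (cases "a' = a")
    case True
    then show ?thesis using assms(6,7) by auto
  next
    case False
    then have less: "a' < a" using a'(2) by simp
    obtain D where D: "\<And>t. t \<in> I \<Longrightarrow> D 0 t = R t"
      "\<And>n t. t \<in> I \<Longrightarrow> (D n has_vector_derivative D (Suc n) t) (at t within I)"
      using assms(2) unfolding smooth_on_interval_def by blast
    have R: "continuous_on I R"
      using continuous_on_vector_derivative[OF D(2)[of _ 0]] D(1) by (simp cong: continuous_on_cong)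
    obtain A A' where A: "A a' = 0" "A' a' = id_blinfun"
      "\<And>t. t \<in> I \<Longrightarrow> (A has_vector_derivative A' t) (at t within I)"
      "\<And>t. t \<in> I \<Longrightarrow> (A' has_vector_derivative - (R t o\<^sub>L A t)) (at t within I)"
      using jacobi_operator_solution[OF assms(1) R a'(1)] by metis
    obtain J J' J'' where J: "J a = 0" "J b = 0" "\<exists>u\<in>I. J u \<noteq> 0"
      "\<And>t. t \<in> I \<Longrightarrow> (J has_vector_derivative J' t) (at t within I)"
      "\<And>t. t \<in> I \<Longrightarrow> (J' has_vector_derivative J'' t) (at t within I)"
      "\<And>t. t \<in> I \<Longrightarrow> J'' t + R t (J t) = 0"
      using assms(7) unfolding conjugate_points_def jacobi_solution_def by blast
    have J'': "(J' has_vector_derivative - R t (J t)) (at t within I)" if "t \<in> I" for t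
      using J(5,6)[OF that] by (simp add: add_eq_0_iff2)
    have sub: "{a..b} \<subseteq> I" "{a'..b} \<subseteq> I"
      using mem_is_interval_1_I[OF assms(1,4,5)] mem_is_interval_1_I[OF assms(1) a'(1) assms(5)]
      by auto
    have "J' a \<noteq> 0"
      using jacobi_zero_unique[OF assms(1) R J(4) J'' assms(4) J(1)] J(3) by blast
    have "\<not> (\<forall>t\<in>{a..b}. inj (A t))"
    proof
      assume inj: "\<forall>t\<in>{a..b}. inj (A t)"
      have "J' a = 0"
      proof (rule no_conjugate_of_nonsingular[OF assms(6), of A A' R J J'])
        fix t assume "t \<in> {a..b}"
        then have t: "t \<in> I" using sub(1) by blast
        show "(A has_vector_derivative A' t) (at t within {a..b})"
          by (rule has_vector_derivative_within_subset[OF A(3)[OF t] sub(1)])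
        show "(A' has_vector_derivative - (R t o\<^sub>L A t)) (at t within {a..b})"
          by (rule has_vector_derivative_within_subset[OF A(4)[OF t] sub(1)])
        show "A' t x \<bullet> A t y = A t x \<bullet> A' t y" for x y
          by (rule jacobi_operator_lagrange[OF assms(1,3) A(3,4) a'(1) A(1) t])
        show "inj (A t)" using inj \<open>t \<in> {a..b}\<close> by blast
        show "(J has_vector_derivative J' t) (at t within {a..b})"
          by (rule has_vector_derivative_within_subset[OF J(4)[OF t] sub(1)])
        show "(J' has_vector_derivative - R t (J t)) (at t within {a..b})"
          by (rule has_vector_derivative_within_subset[OF J''[OF t] sub(1)])
      qed (fact J(1,2))+
      with \<open>J' a \<noteq> 0\<close> show False by simp
    qed
    \<comment> \<open>A kernel vector \<open>v\<close> selects the Jacobi field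
      \<open>A s v\<close>, which vanishes at \<open>a'\<close> and at \<open>t\<close>.\<close>
    then obtain t v where t: "t \<in> {a..b}" and v: "A t v = 0" "v \<noteq> 0"
      using linear_injective_0[OF bounded_linear.linear[OF blinfun.bounded_linear_right]] by metis
    have Av: "((\<lambda>s. A s v) has_vector_derivative A' s v) (at s within I)"
      and A'v: "((\<lambda>s. A' s v) has_vector_derivative - R s (A s v)) (at s within I)" if "s \<in> I" for s
      using bounded_linear.has_vector_derivative[OF blinfun.bounded_linear_left A(3)[OF that]]
        bounded_linear.has_vector_derivative[OF blinfun.bounded_linear_left A(4)[OF that]]
      by (simp_all add: blinfun.minus_left)
    have "jacobi_solution I R (\<lambda>s. A s v)"
      unfolding jacobi_solution_def
      by (rule exI[of _ "\<lambda>s. A' s v"], rule exI[of _ "\<lambda>s. - R s (A s v)"]) (simp add: Av A'v)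
    \<comment> \<open>The field has derivative \<open>v \<noteq> 0\<close> at \<open>a'\<close>,
      whereas vanishing on the nondegenerate interval \<open>{a'..b}\<close> would force that
      derivative to be 0.\<close>
    moreover have "\<exists>u\<in>I. A u v \<noteq> 0"
    proof (rule ccontr)
      assume "\<not> (\<exists>u\<in>I. A u v \<noteq> 0)"
      then have zero: "A s v = 0" if "s \<in> {a'..b}" for s using that sub(2) by blast
      have lt: "a' < b" using less assms(6) by simp
      have "((\<lambda>s. A s v) has_vector_derivative 0) (at a' within {a'..b})"
        using lt zero by (intro has_vector_derivative_transform[OF _ _ has_vector_derivative_const]) auto
      then have "A' a' v = 0"
        using vector_derivative_unique_within_closed_interval[of a' b a' "\<lambda>s. A s v" "A' a' v" 0] lt
          has_vector_derivative_within_subset[OF Av[OF a'(1)] sub(2)] by (simp add: cbox_interval)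
      then show False using A(2) v(2) by simp
    qed
    moreover have "a' < t" "t \<in> I" using less t sub(1) by auto
    ultimately have "conjugate_points I R a' t"
      unfolding conjugate_points_def using a'(1) A(1) v(1) by (intro conjI exI[of _ "\<lambda>s. A s v"]) auto
    then show ?thesis using t by blast
  qed
qed

end
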